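(* Let $p\in(0,1)$ and $\lambda\in(0,1]$. For $f\in\mathcal{V}_p(\lambda)$ write its Taylor expansion as $f(z)=z+\sum_{n=2}^{\infty}a_n(f)z^n$ in the disc $\{z:|z|<p\}$. Then the exact region of variability of the second Taylor coefficient $a_2(f)$ is the disc determined by the inequality $$\left|a_2(f)-\frac1p\right|\le\lambda p;$$ that is, $\{a_2(f): f\in\mathcal{V}_p(\lambda)\}=\{w\in\mathbb{C}: |w-1/p|\le\lambda p\}$.
   Context: $\mathbb{D}=\{z\in\mathbb{C}:|z|<1\}$. For $p\in(0,1)$, $\mathcal{A}(p)$ is the class of all functions $f$ that are holomorphic in $\mathbb{D}\setminus\{p\}$, have a simple pole at $z=p$ (with nonzero residue), and satisfy $f(0)=0$ and $f'(0)=1$. For $f\in\mathcal{A}(p)$ put $U_f(z)=\left(\frac{z}{f(z)}\right)^2 f'(z)-1$, regarded as a meromorphic function on $\mathbb{D}$ with removable singularities (in particular at $z=0$ and $z=p$) filled in; a bound $|U_f(z)|<c$ for all $z\in\mathbb{D}$ includes the requirement that $U_f$ has no poles in $\mathbb{D}$. For $\lambda\in(0,1]$, $\mathcal{V}_p(\lambda)=\{f\in\mathcal{A}(p): |U_f(z)|<\lambda \text{ for all } z\in\mathbb{D}\}$. *)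

theory Defs
  imports "HOL-Complex_Analysis.Complex_Analysis"
begin

text \<open>
  The value of \<open>f\<close> at the pole \<open>p\<close> and outside the unit disc is unconstrained; nothing below
  depends on it.
\<close>

definition class_A :: "real \<Rightarrow> (complex \<Rightarrow> complex) set" where
  "class_A p = {f. f holomorphic_on (ball 0 1 - {complex_of_real p}) \<and>
                   is_pole f (complex_of_real p) \<and> zorder f (complex_of_real p) = -1 \<and>
                   f 0 = 0 \<and> deriv f 0 = 1}"

definition U_fun :: "(complex \<Rightarrow> complex) \<Rightarrow> complex \<Rightarrow> complex" where
  "U_fun f = remove_sings (\<lambda>z. (z / f z)\<^sup>2 * deriv f z - 1)"

text \<open>
  \<^const>\<open>remove_sings\<close> takes the value \<open>0\<close> at a pole (which here occurs at each zero of \<open>f\<close> other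
  than the origin), so the norm bound alone would not exclude poles.
\<close>

definition class_V :: "real \<Rightarrow> real \<Rightarrow> (complex \<Rightarrow> complex) set" where
  "class_V p lam = {f \<in> class_A p. \<forall>z\<in>ball 0 1. \<not> is_pole (U_fun f) z \<and> norm (U_fun f z) < lam}"

definition taylor_coeff :: "(complex \<Rightarrow> complex) \<Rightarrow> nat \<Rightarrow> complex" where
  "taylor_coeff f n = fps_nth (fps_expansion f 0) n"

lemma class_A_taylor_sums:
  assumes "f \<in> class_A p" and "norm z < p" and "p < 1"
  shows "(\<lambda>n. taylor_coeff f n * z ^ n) sums f z"
proof -
  have "f holomorphic_on ball 0 p"
    using assms by (auto simp: class_A_def elim!: holomorphic_on_subset)
  from holomorphic_power_series[OF this, of z] assms(2) show ?thesis
    by (simp add: taylor_coeff_def fps_expansion_def)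
qed

lemma class_A_taylor_coeff_0_1:
  assumes "f \<in> class_A p"
  shows "taylor_coeff f 0 = 0" and "taylor_coeff f 1 = 1"
  using assms by (simp_all add: class_A_def taylor_coeff_def fps_expansion_def)

end

theory Submission
  imports Defs
begin

text \<open>
  Write \<open>f = z / g\<close>. Poles of \<^term>\<open>U_fun f\<close> occur at the zeros of \<open>f\<close> other than the origin, so for
  \<open>f\<close> in the class \<open>g\<close> is holomorphic on the whole disc, with \<open>g 0 = 1\<close>, \<open>g p = 0\<close> and
  \<open>a\<^sub>2 = - g' 0\<close>, and \<open>U\<^sub>f = g - z g' - 1\<close>. The difference quotient \<open>h z = (g z - 1) / z\<close> satisfies
  \<open>h' = - U\<^sub>f / z\<^sup>2\<close>, so the maximum principle gives \<open>\<bar>h'\<bar> \<le> lam\<close>. Since \<open>h 0 = - a\<^sub>2\<close> and \<open>h p = - 1 / p\<close>,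
  the mean value inequality yields \<open>\<bar>a\<^sub>2 - 1 / p\<bar> \<le> lam p\<close>. Conversely, \<open>w = 1 / p + c p\<close> with
  \<open>\<bar>c\<bar> \<le> lam\<close> is attained for \<open>g z = (1 - z / p) (1 - c p z) = 1 - w z + c z\<^sup>2\<close>, where \<open>U\<^sub>f = - c z\<^sup>2\<close>.
\<close>

section \<open>Poles and values of \<open>U_fun\<close>, and the second coefficient\<close>

text \<open>Away from zeros of \<open>f\<close>, \<open>(z / f z)\<^sup>2 * deriv f z\<close> is
  \<open>- z\<^sup>2\<close> times the derivative of \<open>1 / f\<close>. Differentiation preserves
  the pole of \<open>1 / f\<close> at \<open>z0\<close>, and so does the factor
  \<open>- z\<^sup>2\<close>, which does not vanish there. The order of the zero never
  enters.\<close>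

lemma U_fun_pole_at_zero:
  assumes f: "f holomorphic_on S" "open S" "z0 \<in> S" and "z0 \<noteq> 0"
    and zero: "f z0 = 0" and ne: "eventually (\<lambda>z. f z \<noteq> 0) (at z0)"
  shows "is_pole (U_fun f) z0"
proof -
  define F where "F = (\<lambda>z. (z / f z)\<^sup>2 * deriv f z - 1)"
  obtain T where T: "open T" "z0 \<in> T" "\<And>z. z \<in> T - {z0} \<Longrightarrow> f z \<noteq> 0"
    using ne unfolding eventually_at_topological by auto
  define B where "B = S \<inter> T"
  have B: "open B" "z0 \<in> B" "f holomorphic_on B" "\<And>z. z \<in> B - {z0} \<Longrightarrow> f z \<noteq> 0"
    using f T by (auto simp: B_def intro: holomorphic_on_subset)
  have der: "deriv f holomorphic_on B" using B by (intro holomorphic_deriv)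
  have "isCont f z0"
    using B by (meson continuous_on_eq_continuous_at holomorphic_on_imp_continuous_on)
  then have "filterlim f (at 0) (at z0)"
    using zero ne by (simp add: filterlim_at isCont_def)
  then have "is_pole (\<lambda>z. 1 / f z) z0" by (intro is_pole_divide) auto
  moreover have "((\<lambda>z. 1 / f z) has_field_derivative - deriv f z / (f z)\<^sup>2) (at z)"
    if "z \<in> B - {z0}" for z
    using that B by (auto intro!: derivative_eq_intros holomorphic_derivI[of f B] simp: power2_eq_square)
  ultimately have "is_pole (\<lambda>z. - deriv f z / (f z)\<^sup>2) z0"
    by (rule is_pole_deriv'[OF _ B(1,2)])
  then have "is_pole (\<lambda>z. (- z\<^sup>2) * (- deriv f z / (f z)\<^sup>2)) z0"
    using \<open>z0 \<noteq> 0\<close> by (intro is_pole_mult_analytic_nonzero1) (auto intro!: analytic_intros)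
  then have "is_pole (\<lambda>z. (- z\<^sup>2) * (- deriv f z / (f z)\<^sup>2) - 1) z0"
    by (subst is_pole_minus_const_iff)
  then have "is_pole F z0"
    by (simp add: F_def power_divide)
  \<comment> \<open>The singularity must be isolated for the pole of \<open>F\<close> to carry over
    to \<open>remove_sings F\<close>.\<close>
  moreover have "F holomorphic_on B - {z0}"
    unfolding F_def using B der by (auto intro!: holomorphic_intros intro: holomorphic_on_subset)
  then have "isolated_singularity_at F z0"
    using B by (intro isolated_singularity_at_holomorphic) auto
  ultimately show ?thesis unfolding U_fun_def F_def by simp
qed

text \<open>For \<open>f = z / g\<close> the factor \<open>(g z)\<^sup>2\<close> cancels, leaving an
  expression holomorphic on \<open>S\<close>; by continuity its values also fill the singularities
  in \<open>T\<close>. The set \<open>T\<close> contains 0, where \<open>z / f z\<close> is a formal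
  0 / 0, and leaves room for the pole of \<open>f\<close>, where \<open>g\<close> vanishes.\<close>

lemma U_fun_quotient:
  assumes g: "g holomorphic_on S" "open S" and "finite T" "0 \<in> T"
    and f: "\<And>z. z \<in> S - T \<Longrightarrow> f z = z / g z" and ne: "\<And>z. z \<in> S - T \<Longrightarrow> g z \<noteq> 0"
    and "z \<in> S"
  shows "U_fun f z = g z - z * deriv g z - 1"
proof -
  define V where "V = (\<lambda>z. g z - z * deriv g z - 1)"
  have op: "open (S - T)" using g \<open>finite T\<close> by (simp add: finite_imp_closed open_Diff)
  have eq: "(x / f x)\<^sup>2 * deriv f x - 1 = V x" if x: "x \<in> S - T" for x
  proof -
    have "((\<lambda>z. z / g z) has_field_derivative (g x - x * deriv g x) / (g x)\<^sup>2) (at x)"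
      using x ne g by (auto intro!: derivative_eq_intros holomorphic_derivI[of g S] simp: power2_eq_square)
    then have "(f has_field_derivative (g x - x * deriv g x) / (g x)\<^sup>2) (at x)"
      by (rule has_field_derivative_transform_within_open) (use op x f in auto)
    then have "deriv f x = (g x - x * deriv g x) / (g x)\<^sup>2" by (rule DERIV_imp_deriv)
    moreover have "x \<noteq> 0" using x \<open>0 \<in> T\<close> by auto
    ultimately show ?thesis using f[OF x] ne[OF x] by (simp add: V_def)
  qed
  have "V holomorphic_on S" unfolding V_def
    using g by (intro holomorphic_intros holomorphic_deriv) auto
  then have "isCont V z"
    using g \<open>z \<in> S\<close> by (meson continuous_on_eq_continuous_at holomorphic_on_imp_continuous_on)
  then have lim: "V \<midarrow>z\<rightarrow> V z" by (simp add: isCont_def)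
  \<comment> \<open>Keeping \<open>z\<close> itself in the set covers the case that \<open>z\<close>
    lies in \<open>T\<close>: only a punctured neighbourhood has to avoid \<open>T\<close>.\<close>
  have "open (S - (T - {z}))" using g \<open>finite T\<close> by (simp add: finite_imp_closed open_Diff)
  then have "eventually (\<lambda>x. x \<in> S - T) (at z)"
    using \<open>z \<in> S\<close> unfolding eventually_at_topological by (intro exI[of _ "S - (T - {z})"]) auto
  then have "eventually (\<lambda>x. V x = (x / f x)\<^sup>2 * deriv f x - 1) (at z)"
    by eventually_elim (simp add: eq)
  then have "(\<lambda>x. (x / f x)\<^sup>2 * deriv f x - 1) \<midarrow>z\<rightarrow> V z"
    using lim by (rule Lim_transform_eventually[rotated])
  then show ?thesis unfolding U_fun_def V_def by (rule remove_sings_eqI)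
qed

text \<open>Differentiating \<open>f z * g z = z\<close> twice at 0 gives
  \<open>f'' + 2 f' g' = 0\<close> with \<open>f' = 1\<close> there, and the coefficient is half of
  \<open>f''\<close>.\<close>

lemma taylor_coeff_2_quotient:
  assumes f: "f holomorphic_on S" and g: "g holomorphic_on S" and S: "open S" "0 \<in> S"
    and fg: "\<And>z. z \<in> S \<Longrightarrow> f z * g z = z" and "f 0 = 0" "g 0 = 1"
  shows "taylor_coeff f 2 = - deriv g 0"
proof -
  note df = holomorphic_deriv[OF f S(1)] and dg = holomorphic_deriv[OF g S(1)]
  have 1: "deriv f z * g z + f z * deriv g z = 1" if "z \<in> S" for z
  proof -
    have "((\<lambda>z. f z * g z) has_field_derivative deriv f z * g z + f z * deriv g z) (at z)"
      using that S f g by (auto intro!: derivative_eq_intros holomorphic_derivI[of _ S])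
    moreover have "((\<lambda>z. f z * g z) has_field_derivative 1) (at z)"
      by (rule has_field_derivative_transform_within_open[OF DERIV_ident S(1) that]) (simp add: fg)
    ultimately show ?thesis by (rule DERIV_unique)
  qed
  have "((\<lambda>z. deriv f z * g z + f z * deriv g z) has_field_derivative
      deriv (deriv f) 0 * g 0 + deriv f 0 * deriv g 0
      + (deriv f 0 * deriv g 0 + f 0 * deriv (deriv g) 0)) (at 0)"
    using S by (auto intro!: derivative_eq_intros holomorphic_derivI[OF f]
      holomorphic_derivI[OF g] holomorphic_derivI[OF df] holomorphic_derivI[OF dg])
  moreover have "((\<lambda>z. deriv f z * g z + f z * deriv g z) has_field_derivative 0) (at 0)"
    by (rule has_field_derivative_transform_within_open[OF DERIV_const S]) (simp add: 1)
  ultimately have "deriv (deriv f) 0 * g 0 + deriv f 0 * deriv g 0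
      + (deriv f 0 * deriv g 0 + f 0 * deriv (deriv g) 0) = 0"
    by (rule DERIV_unique)
  then have "deriv (deriv f) 0 + 2 * deriv f 0 * deriv g 0 = 0"
    using \<open>f 0 = 0\<close> \<open>g 0 = 1\<close> by (simp add: algebra_simps)
  moreover have "deriv f 0 = 1" using 1[OF S(2)] \<open>f 0 = 0\<close> \<open>g 0 = 1\<close> by simp
  ultimately have "deriv (deriv f) 0 = - 2 * deriv g 0" by (simp add: add_eq_0_iff)
  then show ?thesis by (simp add: taylor_coeff_def fps_expansion_def numeral_2_eq_2)
qed

section \<open>A Schwarz-type estimate\<close>

text \<open>On the circle of radius \<open>r\<close> the hypothesis reads
  \<open>norm (k w) \<le> M / r\<^sup>2\<close>. The maximum principle carries this bound inside,
  and \<open>r\<close> then tends to 1.\<close>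

lemma norm_bound_from_square_mult_bound:
  fixes k :: "complex \<Rightarrow> complex"
  assumes k: "k holomorphic_on ball 0 1"
    and bound: "\<And>z. norm z < 1 \<Longrightarrow> norm (z\<^sup>2 * k z) \<le> M" and "norm z < 1"
  shows "norm (k z) \<le> M"
proof -
  have "r\<^sup>2 * norm (k z) \<le> M" if r: "norm z < r" "r < 1" for r
  proof -
    have "0 < r" using r norm_ge_zero[of z] by linarith
    have "norm (k z) \<le> M / r\<^sup>2"
    proof (rule maximum_modulus_frontier[of k "cball 0 r"])
      have sub: "cball 0 r \<subseteq> ball (0::complex) 1" using r by auto
      then show "k holomorphic_on interior (cball 0 r)"
        using k by (meson holomorphic_on_subset interior_subset)
      show "continuous_on (closure (cball 0 r)) k"
        using continuous_on_subset[OF holomorphic_on_imp_continuous_on[OF k] sub] by simp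
      fix w :: complex assume "w \<in> frontier (cball 0 r)"
      then have w: "norm w = r" using \<open>0 < r\<close> by (simp add: frontier_cball)
      then show "norm (k w) \<le> M / r\<^sup>2"
        using bound[of w] r \<open>0 < r\<close> by (simp add: norm_mult norm_power field_simps)
    qed (use r in auto)
    then show ?thesis using \<open>0 < r\<close> by (simp add: field_simps)
  qed
  then have "eventually (\<lambda>r. r\<^sup>2 * norm (k z) \<le> M) (at_left 1)"
    using \<open>norm z < 1\<close> unfolding eventually_at_left_field by blast
  moreover have "((\<lambda>r. r\<^sup>2 * norm (k z)) \<longlongrightarrow> 1\<^sup>2 * norm (k z)) (at_left 1)"
    by (intro tendsto_intros)
  ultimately have "1\<^sup>2 * norm (k z) \<le> M"
    by (intro tendsto_upperbound) auto
  then show ?thesis by simp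
qed

section \<open>Necessity: the coefficient lies in the disc\<close>

lemma class_V_nonzero:
  assumes f: "f \<in> class_V p lam" and p: "0 < p" "p < 1"
    and z: "norm z < 1" "z \<noteq> 0" "z \<noteq> complex_of_real p"
  shows "f z \<noteq> 0"
proof
  assume "f z = 0"
  let ?S = "ball 0 1 - {complex_of_real p}"
  have hol: "f holomorphic_on ?S" and f0: "f 0 = 0" "deriv f 0 = 1"
    and nopole: "\<not> is_pole (U_fun f) z"
    using f z by (auto simp: class_V_def class_A_def)
  have S: "open ?S" "connected ?S"
    by (auto intro!: connected_open_delete simp: DIM_complex)
  have mem: "0 \<in> ?S" "z \<in> ?S" using p z by auto
  \<comment> \<open>As \<open>f\<close> has derivative 1 at 0, it is not identically zero; on the
    connected punctured disc its zeros are therefore isolated, so that a zero at \<open>z\<close>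
    would force a pole of \<open>U_fun f\<close>.\<close>
  have "\<exists>y\<in>?S. f y \<noteq> 0"
  proof (rule ccontr)
    assume "\<not> ?thesis"
    then have "(f has_field_derivative 0) (at 0)"
      by (intro has_field_derivative_transform_within_open[OF DERIV_const S(1) mem(1)]) auto
    then show False using f0 by (simp add: DERIV_imp_deriv)
  qed
  then obtain y where "y \<in> ?S" "f y \<noteq> 0" by blast
  then have "eventually (\<lambda>x. f x \<noteq> 0) (at z)"
    using non_zero_neighbour_alt[OF hol S mem(2)] by (simp add: eventually_conj_iff)
  then show False using U_fun_pole_at_zero[OF hol S(1) mem(2) z(2) \<open>f z = 0\<close>] nopole by blast
qed

text \<open>The function \<open>g\<close> is \<open>z / f\<close> with two removable singularities
  filled: the limit at 0 is 1 because \<open>f\<close> has derivative 1 there, and the limit at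
  \<open>p\<close> is 0 because \<open>f\<close> has a pole. The value of \<open>f\<close> at
  \<open>p\<close> is arbitrary, so the quotient formula is not claimed there.\<close>

lemma class_V_quotient:
  assumes f: "f \<in> class_V p lam" and p: "0 < p" "p < 1"
  obtains g where "g holomorphic_on ball 0 1" "g 0 = 1" "g (complex_of_real p) = 0"
    "\<And>z. z \<in> ball 0 1 - {0, complex_of_real p} \<Longrightarrow> f z = z / g z \<and> g z \<noteq> 0"
proof
  define q where "q = complex_of_real p"
  have q: "q \<noteq> 0" "norm q < 1" using p by (auto simp: q_def)
  have hol: "f holomorphic_on (ball 0 1 - {q})" and f0: "f 0 = 0" "deriv f 0 = 1"
    and pole: "is_pole f q"
    using f by (auto simp: class_V_def class_A_def q_def)
  have nz: "f z \<noteq> 0" if "z \<in> ball 0 1 - {0, q}" for z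
    using class_V_nonzero[OF f p, of z] that by (auto simp: q_def)
  define g where "g = (\<lambda>z. if z = 0 then 1 else if z = q then 0 else z / f z)"
  show "g 0 = 1" "g (complex_of_real p) = 0" using q by (auto simp: g_def q_def)
  show "f z = z / g z \<and> g z \<noteq> 0" if "z \<in> ball 0 1 - {0, complex_of_real p}" for z
    using that nz[of z] by (auto simp: g_def q_def)
  have lim0: "g \<midarrow>0\<rightarrow> 1"
  proof -
    have "(f has_field_derivative deriv f 0) (at 0)"
      using hol q by (intro holomorphic_derivI[of f "ball 0 1 - {q}"]) auto
    then have "(\<lambda>z. f z / z) \<midarrow>0\<rightarrow> 1" using f0 by (simp add: has_field_derivative_iff)
    then have "(\<lambda>z. inverse (f z / z)) \<midarrow>0\<rightarrow> inverse 1" by (intro tendsto_inverse) auto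
    moreover have "eventually (\<lambda>z. z \<in> - {q} - {0}) (at (0::complex))"
      using q by (intro eventually_at_in_open) auto
    then have "eventually (\<lambda>z. inverse (f z / z) = g z) (at 0)"
      by eventually_elim (auto simp: g_def)
    ultimately show ?thesis using Lim_transform_eventually by fastforce
  qed
  have limq: "g \<midarrow>q\<rightarrow> 0"
  proof -
    have "(\<lambda>z. z / f z) \<midarrow>q\<rightarrow> 0"
      using pole unfolding is_pole_def by (intro tendsto_divide_0[OF tendsto_ident_at])
    moreover have "eventually (\<lambda>z. z \<in> - {0} - {q}) (at q)"
      using q by (intro eventually_at_in_open) auto
    then have "eventually (\<lambda>z. z / f z = g z) (at q)"
      by eventually_elim (auto simp: g_def)
    ultimately show ?thesis by (rule Lim_transform_eventually)
  qed
  show "g holomorphic_on ball 0 1"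
  proof (rule no_isolated_singularity'[where K = "{0, q}"])
    have "(\<lambda>z. z / f z) holomorphic_on (ball 0 1 - {0, q})"
      using nz hol by (intro holomorphic_intros) (auto intro: holomorphic_on_subset)
    then show "g holomorphic_on (ball 0 1 - {0, q})"
      by (rule holomorphic_transform) (auto simp: g_def)
    show "(g \<longlongrightarrow> g z) (at z within ball 0 1)" if "z \<in> {0, q}" for z
      using that lim0 limq q by (auto simp: g_def intro: Lim_at_imp_Lim_at_within)
  qed auto
qed

lemma class_V_taylor_coeff_2_bound:
  assumes f: "f \<in> class_V p lam" and p: "0 < p" "p < 1"
  shows "norm (taylor_coeff f 2 - 1 / complex_of_real p) \<le> lam * p"
proof -
  define q where "q = complex_of_real p"
  have q: "q \<noteq> 0" "norm q = p" "q \<in> ball 0 1" using p by (auto simp: q_def)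
  obtain g where g: "g holomorphic_on ball 0 1" "g 0 = 1" "g q = 0"
    and fg: "\<And>z. z \<in> ball 0 1 - {0, q} \<Longrightarrow> f z = z / g z \<and> g z \<noteq> 0"
    using class_V_quotient[OF f p] unfolding q_def by blast
  have hol: "f holomorphic_on (ball 0 1 - {q})" and f0: "f 0 = 0"
    using f by (auto simp: class_V_def class_A_def q_def)
  have a2: "taylor_coeff f 2 = - deriv g 0"
  proof (rule taylor_coeff_2_quotient[OF hol])
    show "g holomorphic_on (ball 0 1 - {q})" using g by (auto intro: holomorphic_on_subset)
    show "f z * g z = z" if "z \<in> ball 0 1 - {q}" for z
      using fg[of z] f0 that by (cases "z = 0") auto
  qed (use q g f0 in auto)
  define h where "h = (\<lambda>z. if z = 0 then deriv g 0 else (g z - g 0) / (z - 0))"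
  have h: "h holomorphic_on ball 0 1"
    unfolding h_def by (rule pole_lemma_open[OF g(1)]) simp
  have hd: "norm (z\<^sup>2 * deriv h z) \<le> lam" if z: "norm z < 1" for z
  proof -
    have mul: "z * h z = g z - 1" for z using g by (simp add: h_def)
    have "((\<lambda>z. z * h z) has_field_derivative h z + z * deriv h z) (at z)"
      using z h by (auto intro!: derivative_eq_intros holomorphic_derivI[of h "ball 0 1"])
    moreover have "((\<lambda>z. g z - 1) has_field_derivative deriv g z) (at z)"
      using z g by (auto intro!: derivative_eq_intros holomorphic_derivI[of g "ball 0 1"])
    ultimately have d: "h z + z * deriv h z = deriv g z"
      by (auto simp: mul intro: DERIV_unique)
    have "U_fun f z = g z - z * deriv g z - 1"
      by (rule U_fun_quotient[where S = "ball 0 1" and T = "{0, q}"]) (use g fg z in auto)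
    \<comment> \<open>Substituting \<open>g z - 1 = z * h z\<close> and
      \<open>deriv g z = h z + z * deriv h z\<close> cancels the terms in
      \<open>h z\<close>.\<close>
    also have "\<dots> = - (z\<^sup>2 * deriv h z)"
      using mul[of z] by (simp add: d[symmetric] algebra_simps power2_eq_square)
    finally have "norm (z\<^sup>2 * deriv h z) = norm (U_fun f z)" by simp
    then show ?thesis using f z by (auto simp: class_V_def less_imp_le)
  qed
  \<comment> \<open>Mean value inequality on the convex disc, along the segment from 0 to the
    pole.\<close>
  have "norm (h q - h 0) \<le> lam * norm (q - 0)"
  proof (rule field_differentiable_bound[where S = "ball 0 1" and f' = "deriv h"])
    show "(h has_field_derivative deriv h z) (at z within ball 0 1)" if "z \<in> ball 0 1" for z
      using that h by (intro holomorphic_derivI) auto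
    show "norm (deriv h z) \<le> lam" if "z \<in> ball 0 1" for z
      using that h by (intro norm_bound_from_square_mult_bound[OF _ hd])
        (auto intro: holomorphic_deriv)
  qed (use q in auto)
  moreover have "h q - h 0 = taylor_coeff f 2 - 1 / q"
    using q g by (simp add: h_def a2)
  ultimately show ?thesis using q by (simp add: q_def)
qed

section \<open>Sharpness: every point of the disc is attained\<close>

text \<open>The factor \<open>1 - z / q\<close> of \<open>g\<close> produces the pole, and its
  cofactor \<open>e\<close> has no zero in the disc because \<open>norm (c * q) < 1\<close>. Their
  product is a quadratic with linear coefficient \<open>- (1 / q + c * q)\<close> and leading
  coefficient \<open>c\<close>.\<close>

lemma class_V_extremal:
  assumes p: "0 < p" "p < 1" and lam: "lam \<le> 1" and "0 < lam" and c: "norm c \<le> lam"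
  shows "\<exists>f \<in> class_V p lam. taylor_coeff f 2 = 1 / complex_of_real p + c * complex_of_real p"
proof -
  define q where "q = complex_of_real p"
  have q: "q \<noteq> 0" "norm q = p" "q \<in> ball 0 1" using p by (auto simp: q_def)
  define e where "e = (\<lambda>z. 1 - c * q * z)"
  define g where "g = (\<lambda>z. (1 - z / q) * e z)"
  define f where "f = (\<lambda>z. z / g z)"
  have e_nz: "e z \<noteq> 0" if "norm z < 1" for z
  proof -
    have "norm (c * q * z) = norm c * p * norm z" using q by (simp add: norm_mult)
    also have "\<dots> \<le> 1 * 1 * norm z"
      using c lam p by (intro mult_mono) auto
    also have "\<dots> < 1" using that by simp
    finally have "c * q * z \<noteq> 1" by auto
    then show ?thesis by (auto simp: e_def)
  qed
  have g_nz: "g z \<noteq> 0" if "z \<in> ball 0 1 - {q}" for z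
    using that e_nz[of z] q by (auto simp: g_def)
  have ghol: "g holomorphic_on A" and ehol: "e holomorphic_on A" for A
    unfolding g_def e_def using q by (auto intro!: holomorphic_intros)
  have fhol: "f holomorphic_on ball 0 1 - {q}"
    unfolding f_def using g_nz ghol by (intro holomorphic_intros) auto
  have gd: "(g has_field_derivative - (1 / q + c * q) + 2 * c * z) (at z)" for z
    unfolding g_def e_def using q by (auto intro!: derivative_eq_intros simp: field_simps)
  have f0: "f 0 = 0" "g 0 = 1" by (auto simp: f_def g_def e_def)
  have "((\<lambda>z. z / g z) has_field_derivative 1) (at 0)"
    using f0 by (auto intro!: derivative_eq_intros gd)
  then have f'0: "deriv f 0 = 1" unfolding f_def by (rule DERIV_imp_deriv)
  \<comment> \<open>At \<open>z = q\<close> and at zeros of \<open>e\<close> both sides are 0 by the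
    convention for division by zero. The identity thus holds everywhere and can rewrite
    \<open>f\<close> as a function.\<close>
  have f_pole: "f z = (- q * z / e z) / (z - q) ^ 1" for z
    using q by (cases "z = q \<or> e z = 0") (auto simp: f_def g_def field_simps)
  have nhol: "(\<lambda>z. - q * z / e z) holomorphic_on ball 0 1"
    using e_nz ehol by (intro holomorphic_intros) auto
  have "is_pole (\<lambda>z. (- q * z / e z) / (z - q) ^ 1) q"
    using q e_nz[of q] by (intro is_pole_basic[OF nhol]) auto
  moreover have "zorder (\<lambda>z. (- q * z / e z) / (z - q) ^ 1) q = - int 1"
    using q e_nz[of q] by (intro zorder_nonzero_div_power[OF _ _ nhol]) auto
  ultimately have "is_pole f q" "zorder f q = - 1"
    unfolding f_pole[abs_def] by simp_all
  then have A: "f \<in> class_A p"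
    using fhol f0 f'0 unfolding class_A_def q_def by simp
  have U: "U_fun f z = - c * z\<^sup>2" if "z \<in> ball 0 1" for z
  proof -
    have "U_fun f z = g z - z * deriv g z - 1"
      by (rule U_fun_quotient[where S = "ball 0 1" and T = "{0, q}"])
        (use ghol that g_nz in \<open>auto simp: f_def\<close>)
    also have "\<dots> = - c * z\<^sup>2"
      using q unfolding DERIV_imp_deriv[OF gd[of z]]
      by (simp add: g_def e_def field_simps power2_eq_square)
    finally show ?thesis .
  qed
  have "\<not> is_pole (U_fun f) z \<and> norm (U_fun f z) < lam" if z: "z \<in> ball 0 1" for z
  proof
    have "eventually (\<lambda>x. x \<in> ball 0 1 - {z}) (at z)"
      using z by (intro eventually_at_in_open) auto
    then have "eventually (\<lambda>x. U_fun f x = - c * x\<^sup>2) (at z)"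
      by eventually_elim (simp add: U)
    then have "is_pole (U_fun f) z \<longleftrightarrow> is_pole (\<lambda>x. - c * x\<^sup>2) z"
      by (intro is_pole_cong) auto
    moreover have "\<not> is_pole (\<lambda>x. - c * x\<^sup>2) z"
      by (intro analytic_at_imp_no_pole analytic_intros)
    ultimately show "\<not> is_pole (U_fun f) z" by simp
    have "norm (U_fun f z) = norm c * (norm z)\<^sup>2" using U[OF z] by (simp add: norm_mult norm_power)
    also have "\<dots> \<le> lam * (norm z)\<^sup>2" using c by (simp add: mult_right_mono)
    also have "\<dots> < lam * 1"
      using z \<open>0 < lam\<close> by (intro mult_strict_left_mono) (auto simp: power_less_one_iff abs_square_less_1)
    finally show "norm (U_fun f z) < lam" by simp
  qed
  then have "f \<in> class_V p lam" using A by (simp add: class_V_def)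
  moreover have "taylor_coeff f 2 = - deriv g 0"
    by (rule taylor_coeff_2_quotient[OF fhol ghol]) (use q f0 g_nz in \<open>auto simp: f_def\<close>)
  then have "taylor_coeff f 2 = 1 / q + c * q"
    using DERIV_imp_deriv[OF gd[of 0]] by simp
  ultimately show ?thesis unfolding q_def by blast
qed

theorem theorem5:
  fixes p lam :: real
  assumes "0 < p" and "p < 1" and "0 < lam" and "lam \<le> 1"
  shows "{taylor_coeff f 2 | f. f \<in> class_V p lam} =
         {w. norm (w - 1 / complex_of_real p) \<le> lam * p}"
proof (intro subset_antisym subsetI)
  fix w assume "w \<in> {taylor_coeff f 2 | f. f \<in> class_V p lam}"
  then show "w \<in> {w. norm (w - 1 / complex_of_real p) \<le> lam * p}"
    using class_V_taylor_coeff_2_bound assms by blast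
next
  fix w assume w: "w \<in> {w. norm (w - 1 / complex_of_real p) \<le> lam * p}"
  \<comment> \<open>Solves \<open>w = 1 / p + c * p\<close>, which turns the disc of radius
    \<open>lam * p\<close> into \<open>norm c \<le> lam\<close>.\<close>
  define c where "c = (w - 1 / complex_of_real p) / complex_of_real p"
  have "norm c \<le> lam" using w assms by (simp add: c_def norm_divide pos_divide_le_eq)
  then obtain f where "f \<in> class_V p lam"
      "taylor_coeff f 2 = 1 / complex_of_real p + c * complex_of_real p"
    using class_V_extremal assms by blast
  moreover have "1 / complex_of_real p + c * complex_of_real p = w"
    using assms by (simp add: c_def)
  ultimately show "w \<in> {taylor_coeff f 2 | f. f \<in> class_V p lam}" by force
qed

end
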